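(* Let $S\subset\mathbb{R}^n$ be a nonempty closed set satisfying the exterior $\infty$-sphere condition. Then $S$ is convex, or there exists a nonempty, closed and convex set $A\subset\mathbb{R}^n$ such that $S\subset\operatorname{bdry} A$. In fact: if $\operatorname{int} S\neq\emptyset$, then $S$ is convex; and if $\operatorname{int} S=\emptyset$, then there exists a nonempty, closed and convex set $A\subset\mathbb{R}^n$ such that $S\subset\operatorname{bdry} A$.
   Context: $\mathbb{R}^n$ carries the usual inner product $\langle\cdot,\cdot\rangle$ and Euclidean norm $\|\cdot\|$; $\operatorname{int}$ and $\operatorname{bdry}$ denote topological interior and boundary. For a nonempty closed set $S\subset\mathbb{R}^n$ and $s\in S$, the proximal normal cone to $S$ at $s$ is $$N_S^P(s):=\{\zeta\in\mathbb{R}^n : \exists\,\sigma\ge 0 \text{ such that } \langle\zeta,x-s\rangle\le\sigma\|x-s\|^2\ \text{for all } x\in S\}.$$ For $s\in\operatorname{bdry} S$ and $r>0$, a nonzero vector $\zeta\in N_S^P(s)$ is said to be realized by an $r$-sphere if $$\left\langle\frac{\zeta}{\|\zeta\|},x-s\right\rangle\le\frac{1}{2r}\|x-s\|^2\quad\text{for all } x\in S,$$ equivalently, the open ball of radius $r$ centered at $s+r\,\zeta/\|\zeta\|$ does not meet $S$. $S$ satisfies the exterior $r$-sphere condition if for every $s\in\operatorname{bdry} S$ there exists a nonzero vector $\zeta\in N_S^P(s)$ that is realized by an $r$-sphere. $S$ satisfies the exterior $\infty$-sphere condition if it satisfies the exterior $r$-sphere condition for every $r>0$. *)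

theory Defs
  imports "HOL-Analysis.Analysis"
begin

text \<open>The following notions are only meant for a closed set \<open>S\<close>, so that points of
  \<open>frontier S\<close> belong to \<open>S\<close>.\<close>

definition proximal_normal_cone :: "'a::euclidean_space set \<Rightarrow> 'a \<Rightarrow> 'a set" where
  "proximal_normal_cone S s =
     {\<zeta>. \<exists>\<sigma>\<ge>0. \<forall>x\<in>S. \<zeta> \<bullet> (x - s) \<le> \<sigma> * (norm (x - s))\<^sup>2}"

text \<open>Only meant for \<open>s \<in> frontier S\<close>, \<open>r > 0\<close> and nonzero \<open>\<zeta> \<in> proximal_normal_cone S s\<close>;
  these side conditions are imposed in \<open>exterior_sphere_condition\<close>.\<close>

definition realized_by_sphere :: "'a::euclidean_space set \<Rightarrow> 'a \<Rightarrow> real \<Rightarrow> 'a \<Rightarrow> bool" where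
  "realized_by_sphere S s r \<zeta> \<longleftrightarrow>
     (\<forall>x\<in>S. (\<zeta> /\<^sub>R norm \<zeta>) \<bullet> (x - s) \<le> 1 / (2 * r) * (norm (x - s))\<^sup>2)"

definition exterior_sphere_condition :: "real \<Rightarrow> 'a::euclidean_space set \<Rightarrow> bool" where
  "exterior_sphere_condition r S \<longleftrightarrow>
     (\<forall>s\<in>frontier S. \<exists>\<zeta>\<in>proximal_normal_cone S s. \<zeta> \<noteq> 0 \<and> realized_by_sphere S s r \<zeta>)"

text \<open>The vector \<open>\<zeta>\<close> may depend on the radius.\<close>

definition exterior_infinity_sphere_condition :: "'a::euclidean_space set \<Rightarrow> bool" where
  "exterior_infinity_sphere_condition S \<longleftrightarrow> (\<forall>r>0. exterior_sphere_condition r S)"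

end

theory Submission
  imports Defs
begin

text \<open>An exterior \<open>\<infinity>\<close>-sphere condition is a supporting-hyperplane condition in disguise. For
  \<open>s \<in> frontier S\<close>, the unit normals realized by balls of radius \<open>k = 1, 2, \<dots>\<close> accumulate, by
  compactness of the unit sphere, at a unit vector; as \<open>1 / (2 * k)\<close> tends to \<open>0\<close>, the
  limit vector is the outer normal of a half-space that contains \<open>S\<close> and has \<open>s\<close> on its
  boundary (\<open>exterior_infinity_sphere_imp_support\<close>).

  It remains to compare \<open>S\<close> with its convex hull, which lies in each of these half-spaces.
  If \<open>S\<close> has an interior point \<open>a\<close>, a point \<open>x\<close> of the hull outside \<open>S\<close> would be separated from
  \<open>a\<close> by a boundary point of \<open>S\<close> inside the segment from \<open>a\<close> to \<open>x\<close>; the hyperplane there has \<open>a\<close>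
  strictly on one side, so it would have \<open>x\<close> strictly on the other
  (\<open>convex_if_supported_at_frontier\<close>). If \<open>S\<close> has empty interior, every point of \<open>S\<close> is a
  boundary point, and the half-space at that point keeps it out of the interior of the closed
  convex hull of \<open>S\<close>, which serves as \<open>A\<close>.\<close>

lemma subseq_sphere_bound_tendsto_0:
  assumes "strict_mono f"
  shows "(\<lambda>k. 1 / (2 * real (Suc (f k))) * c) \<longlonglongrightarrow> 0"
proof -
  have "(\<lambda>k. c / 2 * inverse (real (Suc k))) \<longlonglongrightarrow> 0"
    by (rule tendsto_mult_right_zero) (rule LIMSEQ_inverse_real_of_nat)
  then have "(\<lambda>k. c / 2 * inverse (real (Suc (f k)))) \<longlonglongrightarrow> 0"
    using LIMSEQ_subseq_LIMSEQ[OF _ assms] unfolding o_def by fast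
  moreover have radius_factor: "1 / (2 * real (Suc n)) * c = c / 2 * inverse (real (Suc n))" for n
    by (simp add: field_split_simps del: of_nat_Suc)
  ultimately show ?thesis
    unfolding radius_factor by fast
qed

lemma exterior_infinity_sphere_imp_support:
  fixes S :: "'a::euclidean_space set"
  assumes "exterior_infinity_sphere_condition S" and "s \<in> frontier S"
  obtains \<zeta> where "\<zeta> \<noteq> 0" and "S \<subseteq> {x. \<zeta> \<bullet> x \<le> \<zeta> \<bullet> s}"
proof -
  have "\<exists>u. norm u = 1 \<and> (\<forall>x\<in>S. u \<bullet> (x - s) \<le> 1 / (2 * real (Suc k)) * (norm (x - s))\<^sup>2)"
    for k
  proof -
    have "exterior_sphere_condition (real (Suc k)) S"
      using assms(1) by (simp add: exterior_infinity_sphere_condition_def)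
    then obtain \<zeta> where "\<zeta> \<noteq> 0" and "realized_by_sphere S s (real (Suc k)) \<zeta>"
      using assms(2) unfolding exterior_sphere_condition_def by blast
    then show ?thesis
      unfolding realized_by_sphere_def
      by (intro exI[of _ "\<zeta> /\<^sub>R norm \<zeta>"]) simp
  qed
  then obtain u where norm_u: "\<And>k. norm (u k) = 1"
    and u: "\<And>k x. x \<in> S \<Longrightarrow> u k \<bullet> (x - s) \<le> 1 / (2 * real (Suc k)) * (norm (x - s))\<^sup>2"
    by metis
  have "seq_compact (sphere (0::'a) 1)"
    by (simp add: compact_imp_seq_compact)
  moreover have "\<forall>k. u k \<in> sphere 0 1"
    using norm_u by simp
  ultimately obtain \<zeta> f where "\<zeta> \<in> sphere 0 1" and f: "strict_mono f"
    and lim: "(u \<circ> f) \<longlonglongrightarrow> \<zeta>"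
    by (rule seq_compactE)
  have "\<zeta> \<bullet> (x - s) \<le> 0" if "x \<in> S" for x
  proof -
    have left: "(\<lambda>k. u (f k) \<bullet> (x - s)) \<longlonglongrightarrow> \<zeta> \<bullet> (x - s)"
      using tendsto_inner[OF lim tendsto_const] by (simp add: o_def)
    show ?thesis
      by (rule LIMSEQ_le[OF left subseq_sphere_bound_tendsto_0[OF f, of "(norm (x - s))\<^sup>2"]])
        (intro exI allI impI u that)
  qed
  then have "S \<subseteq> {x. \<zeta> \<bullet> x \<le> \<zeta> \<bullet> s}"
    by (auto simp: inner_diff_right)
  moreover have "\<zeta> \<noteq> 0"
    using \<open>\<zeta> \<in> sphere 0 1\<close> by auto
  ultimately show thesis
    by (rule that[rotated])
qed

lemma interior_subset_open_halfspace:
  fixes S :: "'a::euclidean_space set"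
  assumes "\<zeta> \<noteq> 0" and "S \<subseteq> {x. \<zeta> \<bullet> x \<le> b}"
  shows "interior S \<subseteq> {x. \<zeta> \<bullet> x < b}"
  using interior_mono[OF assms(2)] interior_halfspace_le[OF assms(1)] by simp

text \<open>A converse of the supporting hyperplane theorem for convex bodies. Without an interior
  point it fails: two points of a line are supported at each of their points.\<close>

lemma convex_if_supported_at_frontier:
  fixes S :: "'a::euclidean_space set"
  assumes "closed S" and "interior S \<noteq> {}"
    and supp: "\<And>s. s \<in> frontier S \<Longrightarrow> \<exists>\<zeta>. \<zeta> \<noteq> 0 \<and> S \<subseteq> {x. \<zeta> \<bullet> x \<le> \<zeta> \<bullet> s}"
  shows "convex S"
proof -
  obtain a where a: "a \<in> interior S"
    using assms(2) by blast
  have "x \<in> S" if x: "x \<in> convex hull S" for x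
  proof (rule ccontr)
    assume "x \<notin> S"
    have "a \<in> S"
      using a interior_subset by blast
    then have "closed_segment a x \<inter> frontier S \<noteq> {}"
      using \<open>x \<notin> S\<close> by (intro connected_Int_frontier) auto
    then obtain s where s: "s \<in> frontier S" and "s \<in> closed_segment a x"
      by blast
    then obtain t where t: "0 \<le> t" "t \<le> 1" and s_eq: "s = (1 - t) *\<^sub>R a + t *\<^sub>R x"
      by (auto simp: closed_segment_def)
    have "s \<in> S"
      using s frontier_subset_closed[OF assms(1)] by blast
    then have "t \<noteq> 1"
      using s_eq \<open>x \<notin> S\<close> by auto
    obtain \<zeta> where \<zeta>: "\<zeta> \<noteq> 0" "S \<subseteq> {y. \<zeta> \<bullet> y \<le> \<zeta> \<bullet> s}"
      using supp[OF s] by blast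
    have "convex hull S \<subseteq> {y. \<zeta> \<bullet> y \<le> \<zeta> \<bullet> s}"
      by (intro hull_minimal \<zeta>(2) convex_halfspace_le)
    then have ax: "\<zeta> \<bullet> a < \<zeta> \<bullet> s" "\<zeta> \<bullet> x \<le> \<zeta> \<bullet> s"
      using interior_subset_open_halfspace[OF \<zeta>] a x by blast+
    have "\<zeta> \<bullet> s = (1 - t) * (\<zeta> \<bullet> a) + t * (\<zeta> \<bullet> x)"
      by (simp add: s_eq inner_add_right)
    also have "\<dots> < (1 - t) * (\<zeta> \<bullet> s) + t * (\<zeta> \<bullet> s)"
      using t \<open>t \<noteq> 1\<close> ax by (intro add_less_le_mono mult_strict_left_mono mult_left_mono) auto
    finally show False
      by (simp add: algebra_simps)
  qed
  then have "convex hull S = S"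
    using hull_subset[of S convex] by blast
  then show ?thesis
    by (metis convex_convex_hull)
qed

theorem theorem2:
  fixes S :: "(real ^ 'n) set"
  assumes "S \<noteq> {}" and "closed S"
    and "exterior_infinity_sphere_condition S"
  shows "(convex S \<or> (\<exists>A :: (real ^ 'n) set. A \<noteq> {} \<and> closed A \<and> convex A \<and> S \<subseteq> frontier A))
    \<and> (interior S \<noteq> {} \<longrightarrow> convex S)
    \<and> (interior S = {} \<longrightarrow>
         (\<exists>A :: (real ^ 'n) set. A \<noteq> {} \<and> closed A \<and> convex A \<and> S \<subseteq> frontier A))"
proof -
  have supp: "\<exists>\<zeta>. \<zeta> \<noteq> 0 \<and> S \<subseteq> {x. \<zeta> \<bullet> x \<le> \<zeta> \<bullet> s}" if "s \<in> frontier S" for s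
    using exterior_infinity_sphere_imp_support[OF assms(3) that] by metis
  have solid: "convex S" if "interior S \<noteq> {}"
    using convex_if_supported_at_frontier[OF assms(2) that supp] by blast
  have thin: "\<exists>A :: (real ^ 'n) set. A \<noteq> {} \<and> closed A \<and> convex A \<and> S \<subseteq> frontier A"
    if "interior S = {}"
  proof -
    let ?A = "closure (convex hull S)"
    have sub: "S \<subseteq> ?A"
      using hull_subset[of S convex] closure_subset by blast
    have "s \<in> frontier ?A" if "s \<in> S" for s
    proof -
      have "s \<in> frontier S"
        using \<open>s \<in> S\<close> \<open>interior S = {}\<close> assms(2) by (simp add: frontier_def)
      then obtain \<zeta> where \<zeta>: "\<zeta> \<noteq> 0" "S \<subseteq> {x. \<zeta> \<bullet> x \<le> \<zeta> \<bullet> s}"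
        using supp by blast
      have "?A \<subseteq> {x. \<zeta> \<bullet> x \<le> \<zeta> \<bullet> s}"
        by (intro closure_minimal hull_minimal \<zeta>(2) convex_halfspace_le closed_halfspace_le)
      then have "s \<notin> interior ?A"
        using interior_subset_open_halfspace[OF \<zeta>(1)] by blast
      then show ?thesis
        using sub \<open>s \<in> S\<close> by (auto simp: frontier_def)
    qed
    then have "S \<subseteq> frontier ?A"
      by (rule subsetI)
    moreover have "?A \<noteq> {}"
      using assms(1) by simp
    moreover have "convex ?A"
      by simp
    ultimately show ?thesis
      by (intro exI[of _ ?A] conjI closed_closure)
  qed
  show ?thesis
  proof (cases "interior S = {}")
    case True
    with thin show ?thesis
      by simp
  next
    case False
    with solid show ?thesis
      by simp
  qed
qed

end
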